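(* Let $C>0$ and let $\varphi:\mathbb N\to(0,+\infty)$ satisfy $\sum_{i=0}^{+\infty}\frac{1}{\varphi(i)}\leq C$. Let $S^{\varphi}$ be the random combined cutoff sequence built from the sequences $S^{(i)}$, $i\in\mathbb N$, given by $S^{(i)}_k=\left(1-2^{-i-2}\right)^{-k}$, with weights $r_i=\frac{1}{C\varphi(i)}$. Then for every distribution $p$ of the running time $T\in[1,+\infty]$, \[ \mathcal{L}_p(S^\varphi)\;\leq\;8C\,\inf_{q\in(0,1]}\frac{Q_p(q)}{q}\,\varphi\!\left(\left\lfloor\log_2\frac{1}{q}\right\rfloor\right). \]
   Context: Restart setup: a Las Vegas algorithm has random running time $T\in[1,+\infty]$ with distribution $p$. Given a (possibly random) cutoff sequence $S\in[1,+\infty)^{\mathbb N}$, the multi-start algorithm runs the algorithm successively with cutoffs $S_0,S_1,\dots$; at round $k$ a fresh copy with running time $T_k$ is run for at most $S_k$, where $T_0,T_1,\dots$ are i.i.d. with distribution $p$ and independent of the randomness used to generate $S$; it stops at $K^\star=\min\{k\geq0:T_k\leq S_k\}$. The expected running time is $\mathcal{L}_p(S)=\mathbb{E}\big[\sum_{k=0}^{K^\star-1}S_k+T_{K^\star}\big]$. The quantile is $Q_p(q)=\min\{\alpha\in[1,+\infty]:\mathbb{P}(T\leq\alpha)\geq q\}$. Combined sequence: given sequences $S^{(i)}$ and nonnegative weights $r_i$ with positive finite sum, initialize counters $K_i=0$; for $k=0,1,\dots$: sample $I$ with probability proportional to $r_i/S^{(i)}_{K_i}$ (independently given the past), set $\tilde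 S_k=S^{(I)}_{K_I}$, and increase $K_I$ by one. *)

theory Defs
  imports "HOL-Probability.Probability"
begin

definition running_time_distribution :: "ennreal measure \<Rightarrow> bool" where
  "running_time_distribution p \<longleftrightarrow>
     prob_space p \<and> sets p = sets borel \<and> (AE t in p. 1 \<le> t)"

(* The infimum is a minimum, see quantile_attained below. *)
definition quantile :: "ennreal measure \<Rightarrow> real \<Rightarrow> ennreal" where
  "quantile p q = Inf {\<alpha>. 1 \<le> \<alpha> \<and> q \<le> measure p {..\<alpha>}}"

(* In the second case no round ever succeeds, i.e. the stopping round is infinite: the
   algorithm then runs through all cutoffs (and never stops if all cutoffs are at least 1). *)
definition running_time :: "(nat \<Rightarrow> real) \<Rightarrow> (nat \<Rightarrow> ennreal) \<Rightarrow> ennreal" where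
  "running_time S T =
     (if \<exists>k. T k \<le> ennreal (S k)
      then let K = (LEAST k. T k \<le> ennreal (S k)) in (\<Sum>k<K. ennreal (S k)) + T K
      else (\<Sum>k. ennreal (S k)))"

definition expected_running_time ::
  "'a measure \<Rightarrow> ('a \<Rightarrow> nat \<Rightarrow> real) \<Rightarrow> (nat \<Rightarrow> 'a \<Rightarrow> ennreal) \<Rightarrow> ennreal" where
  "expected_running_time M S T = (\<integral>\<^sup>+ \<omega>. running_time (S \<omega>) (\<lambda>k. T k \<omega>) \<partial>M)"

(* The value of the counter K_i before step k, when h j is the index selected at step j. *)
definition counter :: "(nat \<Rightarrow> nat) \<Rightarrow> nat \<Rightarrow> nat \<Rightarrow> nat" where
  "counter h k i = card {j. j < k \<and> h j = i}"

(* The random index I k is the one selected at step k; S i is the i-th sequence to combine.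
   selection_law is the law of I k given the past. It determines the joint law of the I k. *)
locale index_selection = prob_space M
  for M :: "'a measure" +
  fixes r :: "nat \<Rightarrow> real"
    and S :: "nat \<Rightarrow> nat \<Rightarrow> real"
    and I :: "nat \<Rightarrow> 'a \<Rightarrow> nat"
  assumes index_measurable: "\<And>k. random_variable (count_space UNIV) (I k)"
    and selection_law:
      "\<And>k h i. \<P>(\<omega> in M. \<forall>j<k. I j \<omega> = h j) > 0 \<Longrightarrow>
        \<P>(\<omega> in M. I k \<omega> = i \<bar> \<forall>j<k. I j \<omega> = h j) =
          (r i / S i (counter h k i)) / (\<Sum>l. r l / S l (counter h k l))"

definition combined_sequence ::
  "(nat \<Rightarrow> nat \<Rightarrow> real) \<Rightarrow> (nat \<Rightarrow> 'a \<Rightarrow> nat) \<Rightarrow> 'a \<Rightarrow> nat \<Rightarrow> real" where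
  "combined_sequence S I \<omega> k = S (I k \<omega>) (counter (\<lambda>j. I j \<omega>) k (I k \<omega>))"

(* The sequences to combine are deterministic, so the selected indices I are all the
   randomness used to generate the combined cutoff sequence. *)
locale fresh_runs = prob_space M
  for M :: "'a measure" +
  fixes p :: "ennreal measure"
    and I :: "nat \<Rightarrow> 'a \<Rightarrow> nat"
    and T :: "nat \<Rightarrow> 'a \<Rightarrow> ennreal"
  assumes runs_indep: "indep_vars (\<lambda>_. borel) T UNIV"
    and runs_distr: "\<And>k. distr M borel (T k) = p"
    and runs_indep_selection:
      "indep_var (PiM UNIV (\<lambda>_. borel)) (\<lambda>\<omega> k. T k \<omega>)
         (PiM UNIV (\<lambda>_. count_space UNIV)) (\<lambda>\<omega> k. I k \<omega>)"

definition geometric_cutoffs :: "nat \<Rightarrow> nat \<Rightarrow> real" where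
  "geometric_cutoffs i k = (1 - 2 powi (- int i - 2)) powi (- int k)"

lemma quantile_attained:
  assumes "running_time_distribution p" and "q \<le> 1"
  shows "1 \<le> quantile p q" and "q \<le> measure p {..quantile p q}"
proof -
  interpret prob_space p
    using assms(1) by (simp add: running_time_distribution_def)
  have sets: "sets p = sets borel"
    using assms(1) by (simp add: running_time_distribution_def)
  have space: "space p = UNIV"
    using sets_eq_imp_space_eq[OF sets] by simp
  define A where "A = {\<alpha>. 1 \<le> \<alpha> \<and> q \<le> measure p {..\<alpha>}}"
  have Q: "quantile p q = Inf A"
    by (simp add: quantile_def A_def)
  have "{..top::ennreal} = space p"
    using space by auto
  then have "top \<in> A"
    using assms(2) prob_space by (auto simp: A_def)
  then have "A \<noteq> {}"
    by blast
  show "1 \<le> quantile p q"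
    unfolding Q by (rule Inf_greatest) (simp add: A_def)
  obtain f :: "nat \<Rightarrow> ennreal" where f: "decseq f" "range f \<subseteq> A" "Inf A = (INF i. f i)"
    using ennreal_Inf_countable_INF[OF \<open>A \<noteq> {}\<close>] by blast
  have "(\<Inter>i. {..f i}) = {..Inf A}"
    unfolding f(3) by (auto simp: le_INF_iff)
  moreover have "(\<lambda>i. measure p {..f i}) \<longlonglongrightarrow> measure p (\<Inter>i. {..f i})"
    using f(1) by (intro finite_Lim_measure_decseq) (auto simp: sets decseq_def)
  ultimately have "(\<lambda>i. measure p {..f i}) \<longlonglongrightarrow> measure p {..Inf A}"
    by simp
  then show "q \<le> measure p {..quantile p q}"
    unfolding Q by (rule LIMSEQ_le_const) (use f(2) in \<open>auto simp: A_def\<close>)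
qed

end

theory Submission
  imports Defs
begin

text \<open>Since the selection probabilities are proportional to \<open>r i / S i\<close>, every round spends, in expectation, a
  cost on sequence \<open>i\<close> that is proportional to \<open>r i\<close>. Hence the total expected cost is at most
  \<open>(\<Sum>j. r j) / r i\<close> times the cost spent on sequence \<open>i\<close> alone, for any \<open>i\<close>. The latter is bounded
  with a potential depending only on how often sequence \<open>i\<close> has been used. For a target \<open>q\<close>, take
  \<open>i = \<lfloor>log 2 (1 / q)\<rfloor>\<close> and \<open>e = 1 / (4 * 2 ^ i)\<close>, so that \<open>2 * e \<le> q\<close>: once the
  cutoffs of sequence \<open>i\<close> reach the quantile, each further use multiplies the cutoff by \<open>1 / (1 - e)\<close>
  but the survival probability by at most \<open>1 - 2 * e\<close>, and the cost series converges.\<close>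

section \<open>Pathwise bound on the cost of a run\<close>

text \<open>Every round that is reached is charged its full cutoff, so only the successful round is
  overcharged: \<open>T K\<close> becomes \<open>S K\<close>. The result is a series of nonnegative
  terms, which can be integrated round by round.\<close>

lemma running_time_le_suminf:
  "running_time S T \<le> (\<Sum>k. if \<forall>j<k. ennreal (S j) < T j then ennreal (S k) else 0)"
  (is "_ \<le> suminf ?f")
proof (cases "\<exists>k. T k \<le> ennreal (S k)")
  case True
  define K where "K = (LEAST k. T k \<le> ennreal (S k))"
  have stop: "T K \<le> ennreal (S K)"
    unfolding K_def using True by (rule LeastI_ex)
  have alive: "ennreal (S j) < T j" if "j < K" for j
    using not_less_Least[of j "\<lambda>k. T k \<le> ennreal (S k)"] that by (simp add: K_def not_le)
  have "running_time S T = (\<Sum>k<K. ennreal (S k)) + T K"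
    using True by (simp add: running_time_def K_def Let_def)
  also have "\<dots> \<le> (\<Sum>k<Suc K. ennreal (S k))"
    using stop by (simp add: add_left_mono)
  also have "\<dots> = sum ?f {..<Suc K}"
    using alive by (intro sum.cong) auto
  also have "\<dots> \<le> suminf ?f"
    by (intro sum_le_suminf) auto
  finally show ?thesis .
next
  case False
  then have "ennreal (S k) < T k" for k
    by (simp add: not_le)
  then show ?thesis
    using False by (simp add: running_time_def)
qed

section \<open>Integrals of countably valued random variables\<close>

context prob_space
begin

text \<open>Split \<open>A\<close> by the value of \<open>X\<close> and exchange the integrals;
  countability makes the counting measure sigma-finite, as Fubini requires. Integrals over histories
  thus reduce to probabilities of single histories.\<close>

lemma nn_integral_indicator_countable:
  fixes X :: "'a \<Rightarrow> 'b::countable"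
  assumes [measurable]: "X \<in> measurable M (count_space UNIV)" "A \<in> sets M"
  shows "(\<integral>\<^sup>+ \<omega>. indicator A \<omega> * f (X \<omega>) \<partial>M) =
    (\<integral>\<^sup>+ x. f x * emeasure M {\<omega>\<in>A. X \<omega> = x} \<partial>count_space UNIV)"
proof -
  interpret c: sigma_finite_measure "count_space (UNIV :: 'b set)"
    by (rule sigma_finite_measure_count_space_countable) simp
  interpret pair_sigma_finite "count_space (UNIV :: 'b set)" M ..
  have sets: "{\<omega>\<in>A. X \<omega> = x} \<in> sets M" for x
  proof -
    have "{\<omega>\<in>A. X \<omega> = x} = A \<inter> (X -` {x} \<inter> space M)"
      using sets.sets_into_space[OF assms(2)] by auto
    also have "\<dots> \<in> sets M" by simp
    finally show ?thesis .
  qed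
  have meas: "(\<lambda>(x, \<omega>). f x * indicator {\<omega>\<in>A. X \<omega> = x} \<omega>)
      \<in> borel_measurable (count_space UNIV \<Otimes>\<^sub>M M)"
    by (rule measurable_pair_measure_countable1) (use sets in auto)
  have "(\<integral>\<^sup>+ \<omega>. indicator A \<omega> * f (X \<omega>) \<partial>M) =
      (\<integral>\<^sup>+ \<omega>. (\<integral>\<^sup>+ x. f x * indicator {\<omega>\<in>A. X \<omega> = x} \<omega> \<partial>count_space UNIV) \<partial>M)"
  proof (intro nn_integral_cong)
    fix \<omega>
    have "(\<integral>\<^sup>+ x. f x * indicator {\<omega>\<in>A. X \<omega> = x} \<omega> \<partial>count_space UNIV) =
        (\<integral>\<^sup>+ x. (indicator A \<omega> * f x) * indicator {X \<omega>} x \<partial>count_space UNIV)"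
      by (intro nn_integral_cong) (auto simp: indicator_def)
    also have "\<dots> = indicator A \<omega> * f (X \<omega>)"
      by (subst nn_integral_count_space_indicator[symmetric])
        (simp_all add: nn_integral_count_space_finite indicator_def)
    finally show "indicator A \<omega> * f (X \<omega>) =
        (\<integral>\<^sup>+ x. f x * indicator {\<omega>\<in>A. X \<omega> = x} \<omega> \<partial>count_space UNIV)" ..
  qed
  also have "\<dots> = (\<integral>\<^sup>+ x. (\<integral>\<^sup>+ \<omega>. f x * indicator {\<omega>\<in>A. X \<omega> = x} \<omega> \<partial>M) \<partial>count_space UNIV)"
    using Fubini'[OF meas] by simp
  also have "\<dots> = (\<integral>\<^sup>+ x. f x * emeasure M {\<omega>\<in>A. X \<omega> = x} \<partial>count_space UNIV)"
    using sets by (intro nn_integral_cong) (simp add: nn_integral_cmult)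
  finally show ?thesis .
qed

end

section \<open>Histories of the selection and measurability\<close>

locale restarted_selection =
  index_selection M r S I + fresh_runs M p I T
  for M :: "'a measure" and r S I p T +
  assumes weight_nonneg: "\<And>i. 0 \<le> r i"
    and weight_summable: "summable r"
    and weight_pos: "\<exists>i. 0 < r i"
    and cutoff_ge_1: "\<And>i k. 1 \<le> S i k"
begin

text \<open>The past is encoded as a list, a value of a countable type: conditioning on it is a sum,
  and every function of it is measurable.\<close>

definition history :: "nat \<Rightarrow> 'a \<Rightarrow> nat list" where
  "history k \<omega> = map (\<lambda>j. I j \<omega>) [0..<k]"

definition weight_sum :: "nat list \<Rightarrow> real" where
  "weight_sum xs = (\<Sum>l. r l / S l (count_list xs l))"

definition selection :: "nat list \<Rightarrow> nat \<Rightarrow> real" where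
  "selection xs l = r l / S l (count_list xs l) / weight_sum xs"

text \<open>The combined cutoff of round \<open>j\<close> as a function of the list alone, hence a
  constant once the history is fixed.\<close>

definition cutoff :: "nat list \<Rightarrow> nat \<Rightarrow> real" where
  "cutoff xs j = S (xs ! j) (count_list (take j xs) (xs ! j))"

definition survival :: "real \<Rightarrow> real" where
  "survival s = measure p {ennreal s<..}"

definition alive :: "nat \<Rightarrow> 'a set" where
  "alive k = {\<omega>\<in>space M. \<forall>j<k. ennreal (combined_sequence S I \<omega> j) < T j \<omega>}"

lemma length_history [simp]: "length (history k \<omega>) = k"
  by (simp add: history_def)

lemma history_Suc: "history (Suc k) \<omega> = history k \<omega> @ [I k \<omega>]"
  by (simp add: history_def)

lemma history_eq_iff: "history (length xs) \<omega> = xs \<longleftrightarrow> (\<forall>j<length xs. I j \<omega> = xs ! j)"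
  unfolding list_eq_iff_nth_eq by (simp add: history_def)

lemma counter_eq_count_list: "k \<le> length xs \<Longrightarrow> counter ((!) xs) k i = count_list (take k xs) i"
proof (induction k)
  case (Suc k)
  have "{j. j < Suc k \<and> xs ! j = i} =
      (if xs ! k = i then insert k {j. j < k \<and> xs ! j = i} else {j. j < k \<and> xs ! j = i})"
    by (auto simp: less_Suc_eq)
  then show ?case
    using Suc by (auto simp: counter_def take_Suc_conv_app_nth)
qed (simp add: counter_def)

lemma counter_history: "counter (\<lambda>j. I j \<omega>) k i = count_list (history k \<omega>) i"
proof -
  have "counter (\<lambda>j. I j \<omega>) k i = counter ((!) (history k \<omega>)) k i"
    unfolding counter_def by (intro arg_cong[of _ _ card] Collect_cong) (auto simp: history_def)
  then show ?thesis
    by (simp add: counter_eq_count_list)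
qed

lemma combined_sequence_eq:
  "combined_sequence S I \<omega> k = S (I k \<omega>) (count_list (history k \<omega>) (I k \<omega>))"
  by (simp add: combined_sequence_def counter_history)

lemma combined_sequence_eq_cutoff:
  assumes "history n \<omega> = xs" "j < n"
  shows "combined_sequence S I \<omega> j = cutoff xs j"
proof -
  have "xs ! j = I j \<omega>" "take j xs = history j \<omega>"
    using assms by (auto simp: history_def take_map)
  then show ?thesis
    by (simp add: combined_sequence_eq cutoff_def)
qed

lemma cutoff_append [simp]: "j < length xs \<Longrightarrow> cutoff (xs @ ys) j = cutoff xs j"
  by (simp add: cutoff_def nth_append)

lemma I_measurable [measurable]: "I k \<in> measurable M (count_space UNIV)"
  by (rule index_measurable)

lemma T_measurable [measurable]: "T k \<in> borel_measurable M"
  using runs_indep by (simp add: indep_vars_def2)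

lemma history_measurable [measurable]: "history k \<in> measurable M (count_space UNIV)"
proof (induction k)
  case 0
  then show ?case by (simp add: history_def)
next
  case (Suc k)
  have "(\<lambda>\<omega>. (\<lambda>xs. xs @ [l]) (history k \<omega>)) \<in> measurable M (count_space UNIV)" for l
    by (rule measurable_compose[OF Suc]) simp
  then show ?case
    unfolding history_Suc[abs_def] by (rule measurable_compose_countable) measurable
qed

lemma combined_sequence_measurable [measurable]:
  "(\<lambda>\<omega>. combined_sequence S I \<omega> k) \<in> borel_measurable M"
proof -
  have "(\<lambda>\<omega>. S l (count_list (history k \<omega>) l)) \<in> borel_measurable M" for l
    by (rule measurable_compose[OF history_measurable]) simp
  then show ?thesis
    unfolding combined_sequence_eq[abs_def] by (rule measurable_compose_countable) measurable
qed

lemma alive_sets [measurable]: "alive k \<in> sets M"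
  unfolding alive_def by measurable

section \<open>Selection probabilities\<close>

lemma summable_weights: "summable (\<lambda>l. r l / S l (n l))"
proof (rule summable_comparison_test'[OF weight_summable])
  show "norm (r l / S l (n l)) \<le> r l" for l
    using weight_nonneg[of l] cutoff_ge_1[of l "n l"] mult_left_mono[of 1 "S l (n l)" "r l"]
    by (simp add: field_simps)
qed

lemma weight_sum_pos: "0 < weight_sum xs"
proof -
  obtain i where "0 < r i"
    using weight_pos by blast
  have S_pos: "0 < S l k" for l k
    using cutoff_ge_1[of l k] by simp
  show ?thesis
    unfolding weight_sum_def
    by (rule suminf_pos2[OF summable_weights, of _ i])
      (use \<open>0 < r i\<close> weight_nonneg S_pos in \<open>auto simp: less_imp_le\<close>)
qed

lemma selection_nonneg: "0 \<le> selection xs l"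
  using weight_nonneg[of l] cutoff_ge_1[of l "count_list xs l"] weight_sum_pos[of xs]
  by (simp add: selection_def)

lemma suminf_selection: "(\<Sum>l. ennreal (selection xs l)) = 1"
proof -
  have "(\<lambda>l. selection xs l) sums (weight_sum xs / weight_sum xs)"
    unfolding selection_def
    by (intro sums_divide) (simp add: weight_sum_def summable_sums summable_weights)
  then have "(\<lambda>l. selection xs l) sums 1"
    using weight_sum_pos[of xs] by simp
  then have "(\<Sum>l. ennreal (selection xs l)) = ennreal 1"
    by (intro suminf_ennreal_eq) (auto simp: selection_nonneg)
  then show ?thesis by simp
qed

lemma selection_times_cutoff:
  "selection xs l * S l (count_list xs l) = r l / weight_sum xs"
  using cutoff_ge_1[of l "count_list xs l"] by (simp add: selection_def)

text \<open>Selecting with probability proportional to \<open>r l / S l\<close> makes the expected cost spent on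
  each sequence proportional to its weight.\<close>

lemma weight_times_expected_cutoff:
  "ennreal (r i) * (\<Sum>l. ennreal (selection xs l) * ennreal (S l (count_list xs l))) =
   ennreal (suminf r) * (ennreal (selection xs i) * ennreal (S i (count_list xs i)))"
proof -
  have eq: "ennreal (selection xs l) * ennreal (S l (count_list xs l)) = ennreal (r l / weight_sum xs)"
    for l
    by (simp add: ennreal_mult'[symmetric] selection_nonneg selection_times_cutoff)
  have "(\<Sum>l. ennreal (r l / weight_sum xs)) = ennreal (suminf r / weight_sum xs)"
    using weight_sum_pos[of xs] weight_nonneg weight_summable
    by (intro suminf_ennreal_eq sums_divide summable_sums) (auto simp: less_imp_le)
  then show ?thesis
    using weight_sum_pos[of xs] weight_nonneg suminf_nonneg[OF weight_summable]
    unfolding eq by (simp add: ennreal_mult'[symmetric] mult.commute)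
qed

section \<open>Joint law of history and survival\<close>

text \<open>This is \<open>selection_law\<close> in product form. On null histories, about which
  that law is silent, both sides vanish, so no positivity condition remains.\<close>

lemma prob_history_snoc:
  "prob {\<omega>\<in>space M. history (Suc (length xs)) \<omega> = xs @ [l]} =
   prob {\<omega>\<in>space M. history (length xs) \<omega> = xs} * selection xs l"
proof -
  let ?B = "{\<omega>\<in>space M. history (length xs) \<omega> = xs}"
  have sub: "{\<omega>\<in>space M. history (Suc (length xs)) \<omega> = xs @ [l]} \<subseteq> ?B"
    by (auto simp: history_Suc)
  show ?thesis
  proof (cases "prob ?B = 0")
    case True
    have "prob {\<omega>\<in>space M. history (Suc (length xs)) \<omega> = xs @ [l]} \<le> prob ?B"
      by (rule finite_measure_mono[OF sub]) measurable
    then show ?thesis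
      using True by (simp add: measure_le_0_iff)
  next
    case False
    then have pos: "0 < prob {\<omega>\<in>space M. \<forall>j<length xs. I j \<omega> = xs ! j}"
      by (simp add: history_eq_iff zero_less_measure_iff)
    have "\<P>(\<omega> in M. I (length xs) \<omega> = l \<bar> \<forall>j<length xs. I j \<omega> = xs ! j) = selection xs l"
      using selection_law[OF pos, of l]
      by (simp add: counter_eq_count_list selection_def weight_sum_def)
    then have "prob {\<omega>\<in>space M. I (length xs) \<omega> = l \<and> (\<forall>j<length xs. I j \<omega> = xs ! j)} =
        prob {\<omega>\<in>space M. \<forall>j<length xs. I j \<omega> = xs ! j} * selection xs l"
      using pos by (simp add: cond_prob_def field_simps)
    then show ?thesis
      by (simp add: history_Suc history_eq_iff conj_commute)
  qed
qed

lemma survival_eq: "survival s = prob (T k -` {ennreal s<..} \<inter> space M)"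
  using measure_distr[OF T_measurable, of "{ennreal s<..}" k] by (simp add: survival_def runs_distr)

lemma prob_all_survive:
  "prob {\<omega>\<in>space M. \<forall>j<k. ennreal (s j) < T j \<omega>} = (\<Prod>j<k. survival (s j))"
\<comment> \<open>An intersection over no rounds would be \<open>UNIV\<close> instead of
  \<open>space M\<close>.\<close>
proof (cases "k = 0")
  case True
  then show ?thesis by (simp add: prob_space)
next
  case False
  have "{\<omega>\<in>space M. \<forall>j<k. ennreal (s j) < T j \<omega>} =
      (\<Inter>j\<in>{..<k}. T j -` {ennreal (s j)<..} \<inter> space M)"
    using False by auto
  also have "prob \<dots> = (\<Prod>j<k. prob (T j -` {ennreal (s j)<..} \<inter> space M))"
    using False by (intro indep_varsD[OF runs_indep]) auto
  also have "\<dots> = (\<Prod>j<k. survival (s j))"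
    by (intro prod.cong refl survival_eq[symmetric])
  finally show ?thesis .
qed

text \<open>A fixed history makes the cutoffs constants, so being alive becomes an event about
  \<open>T\<close> only, independent of the selection. The history may be longer than
  \<open>k\<close>, which allows the index of round \<open>k\<close> to be fixed too.\<close>

lemma prob_alive_history:
  assumes "k \<le> length xs"
  shows "prob {\<omega>\<in>alive k. history (length xs) \<omega> = xs} =
    (\<Prod>j<k. survival (cutoff xs j)) * prob {\<omega>\<in>space M. history (length xs) \<omega> = xs}"
proof -
  \<comment> \<open>\<open>indep_var\<close> takes values of one type, so in \<open>runs_indep_selection\<close> the indices are
    coerced to \<^typ>\<open>ennreal\<close>.\<close>
  let ?A = "{t \<in> space (PiM UNIV (\<lambda>_::nat. borel :: ennreal measure)). \<forall>j<k. ennreal (cutoff xs j) < t j}"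
  let ?B = "{h \<in> space (PiM UNIV (\<lambda>_::nat. count_space (UNIV :: ennreal set))).
    \<forall>j<length xs. h j = of_nat (xs ! j)}"
  have "?A \<in> sets (PiM UNIV (\<lambda>_. borel))" by measurable
  moreover have "?B \<in> sets (PiM UNIV (\<lambda>_. count_space UNIV))" by measurable
  moreover have "{\<omega>\<in>alive k. history (length xs) \<omega> = xs} =
      (\<lambda>\<omega>. (\<lambda>k. T k \<omega>, \<lambda>k. of_nat (I k \<omega>))) -` (?A \<times> ?B) \<inter> space M"
    using assms combined_sequence_eq_cutoff[of "length xs" _ xs]
    by (auto simp: alive_def space_PiM history_eq_iff)
  ultimately have "prob {\<omega>\<in>alive k. history (length xs) \<omega> = xs} =
      prob ((\<lambda>\<omega> k. T k \<omega>) -` ?A \<inter> space M) * prob ((\<lambda>\<omega> k. of_nat (I k \<omega>)) -` ?B \<inter> space M)"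
    using indep_varD[OF runs_indep_selection, of ?A ?B] by simp
  also have "(\<lambda>\<omega> k. T k \<omega>) -` ?A \<inter> space M = {\<omega>\<in>space M. \<forall>j<k. ennreal (cutoff xs j) < T j \<omega>}"
    by (auto simp: space_PiM)
  also have "(\<lambda>\<omega> k. of_nat (I k \<omega>)) -` ?B \<inter> space M = {\<omega>\<in>space M. history (length xs) \<omega> = xs}"
    by (auto simp: space_PiM history_eq_iff)
  finally show ?thesis
    by (simp add: prob_all_survive)
qed

lemma survival_nonneg: "0 \<le> survival s"
  by (simp add: survival_def)

lemma survival_le_1: "survival s \<le> 1"
  by (simp add: survival_eq[of _ 0])

section \<open>Averaging over one round\<close>

text \<open>Given the history, reaching round \<open>k\<close> depends only on earlier running
  times, so \<open>I k\<close> still has the law \<open>selection\<close>. The index can therefore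
  be averaged out inside the integral.\<close>

lemma nn_integral_alive_select:
  "(\<integral>\<^sup>+ \<omega>. indicator (alive k) \<omega> * f (history k \<omega>) (I k \<omega>) \<partial>M) =
   (\<integral>\<^sup>+ \<omega>. indicator (alive k) \<omega> *
      (\<Sum>l. ennreal (selection (history k \<omega>) l) * f (history k \<omega>) l) \<partial>M)"
proof -
  let ?\<mu> = "\<lambda>xs. emeasure M {\<omega>\<in>alive k. history k \<omega> = xs}"
  have meas: "(\<lambda>\<omega>. (history k \<omega>, I k \<omega>)) \<in> measurable M (count_space UNIV)"
  proof -
    have "(\<lambda>\<omega>. (\<lambda>xs. (xs, l)) (history k \<omega>)) \<in> measurable M (count_space UNIV)" for l
      by (rule measurable_compose[OF history_measurable]) simp
    then show ?thesis
      by (rule measurable_compose_countable) measurable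
  qed
  have joint: "emeasure M {\<omega>\<in>alive k. (history k \<omega>, I k \<omega>) = (xs, l)} =
      ?\<mu> xs * ennreal (selection xs l)" for xs l
  proof (cases "length xs = k")
    case True
    have "{\<omega>\<in>alive k. (history k \<omega>, I k \<omega>) = (xs, l)} =
        {\<omega>\<in>alive k. history (length (xs @ [l])) \<omega> = xs @ [l]}"
      using True by (auto simp: history_Suc)
    \<comment> \<open>Both probabilities contain the same product of \<open>k\<close> survival
      factors, so the ratio is that of the histories alone.\<close>
    moreover have "prob {\<omega>\<in>alive k. history (length (xs @ [l])) \<omega> = xs @ [l]} =
        prob {\<omega>\<in>alive k. history (length xs) \<omega> = xs} * selection xs l"
      using True prob_alive_history[of k "xs @ [l]"] prob_alive_history[of k xs]
        prob_history_snoc[of xs l]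
      by simp
    ultimately show ?thesis
      using True by (simp add: emeasure_eq_measure ennreal_mult' selection_nonneg)
  next
    case False
    then have "{\<omega>\<in>alive k. (history k \<omega>, I k \<omega>) = (xs, l)} = {}" "{\<omega>\<in>alive k. history k \<omega> = xs} = {}"
      by auto
    then show ?thesis by (simp only: emeasure_empty mult_zero_left)
  qed
  have "(\<integral>\<^sup>+ \<omega>. indicator (alive k) \<omega> * f (history k \<omega>) (I k \<omega>) \<partial>M) =
      (\<integral>\<^sup>+ x. f (fst x) (snd x) * emeasure M {\<omega>\<in>alive k. (history k \<omega>, I k \<omega>) = x} \<partial>count_space UNIV)"
    using nn_integral_indicator_countable[OF meas alive_sets, of k "\<lambda>x. f (fst x) (snd x)"] by simp
  also have "\<dots> = (\<integral>\<^sup>+ xs. (\<integral>\<^sup>+ l. f xs l * (?\<mu> xs * ennreal (selection xs l)) \<partial>count_space UNIV)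
      \<partial>count_space UNIV)"
    by (subst nn_integral_fst_count_space[symmetric]) (simp add: joint del: prod.inject)
  also have "\<dots> = (\<integral>\<^sup>+ xs. (\<Sum>l. ennreal (selection xs l) * f xs l) * ?\<mu> xs \<partial>count_space UNIV)"
    by (intro nn_integral_cong, subst ennreal_suminf_multc[symmetric])
      (simp add: nn_integral_count_space_nat mult_ac)
  also have "\<dots> = (\<integral>\<^sup>+ \<omega>. indicator (alive k) \<omega> *
      (\<Sum>l. ennreal (selection (history k \<omega>) l) * f (history k \<omega>) l) \<partial>M)"
    by (rule nn_integral_indicator_countable[symmetric]) measurable
  finally show ?thesis .
qed

text \<open>Since \<open>T k\<close> is fresh, surviving round \<open>k\<close> contributes just one
  more factor once the history including \<open>I k\<close> is fixed.\<close>

lemma nn_integral_alive_Suc: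
  "(\<integral>\<^sup>+ \<omega>. indicator (alive (Suc k)) \<omega> * f (history k \<omega>) (I k \<omega>) \<partial>M) =
   (\<integral>\<^sup>+ \<omega>. indicator (alive k) \<omega> *
     (ennreal (survival (combined_sequence S I \<omega> k)) * f (history k \<omega>) (I k \<omega>)) \<partial>M)"
proof -
  \<comment> \<open>The history of length \<open>Suc k\<close> is one random variable carrying both
    arguments of \<open>f\<close>.\<close>
  let ?g = "\<lambda>ys. f (butlast ys) (last ys)"
  let ?H = "history (Suc k)"
  have joint: "emeasure M {\<omega>\<in>alive (Suc k). ?H \<omega> = ys} =
      ennreal (survival (cutoff ys k)) * emeasure M {\<omega>\<in>alive k. ?H \<omega> = ys}" for ys
  proof (cases "length ys = Suc k")
    case True
    then show ?thesis
      using prob_alive_history[of k ys] prob_alive_history[of "Suc k" ys]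
      by (simp add: emeasure_eq_measure ennreal_mult'[symmetric] survival_nonneg mult_ac)
  next
    case False
    then have "{\<omega>\<in>alive n. ?H \<omega> = ys} = {}" for n
      by auto
    then show ?thesis by (simp only: emeasure_empty mult_zero_right)
  qed
  have "(\<integral>\<^sup>+ \<omega>. indicator (alive (Suc k)) \<omega> * ?g (?H \<omega>) \<partial>M) =
      (\<integral>\<^sup>+ ys. ?g ys * emeasure M {\<omega>\<in>alive (Suc k). ?H \<omega> = ys} \<partial>count_space UNIV)"
    by (rule nn_integral_indicator_countable) measurable
  also have "\<dots> = (\<integral>\<^sup>+ ys. (ennreal (survival (cutoff ys k)) * ?g ys) *
      emeasure M {\<omega>\<in>alive k. ?H \<omega> = ys} \<partial>count_space UNIV)"
    by (simp add: joint mult_ac)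
  also have "\<dots> = (\<integral>\<^sup>+ \<omega>. indicator (alive k) \<omega> *
      (ennreal (survival (cutoff (?H \<omega>) k)) * ?g (?H \<omega>)) \<partial>M)"
    by (rule nn_integral_indicator_countable[symmetric]) measurable
  finally show ?thesis
    by (simp add: combined_sequence_eq_cutoff[OF refl lessI] history_Suc)
qed

section \<open>Expected cost charged to one sequence\<close>

text \<open>The selection probability stands in place of the indicator of \<open>I k = i\<close>:
  the index of the round is already averaged out.\<close>

definition step_cost :: "nat \<Rightarrow> nat \<Rightarrow> ennreal" where
  "step_cost i k = (\<integral>\<^sup>+ \<omega>. indicator (alive k) \<omega> *
     (ennreal (selection (history k \<omega>) i) * ennreal (S i (count_list (history k \<omega>) i))) \<partial>M)"

lemma history_fun_measurable [measurable]:
  "(\<lambda>\<omega>. f (history k \<omega>)) \<in> borel_measurable M"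
  by (rule measurable_compose[OF history_measurable]) simp

lemma weight_times_round_cost:
  "ennreal (r i) * (\<integral>\<^sup>+ \<omega>. indicator (alive k) \<omega> * ennreal (combined_sequence S I \<omega> k) \<partial>M) =
   ennreal (suminf r) * step_cost i k"
proof -
  have "(\<integral>\<^sup>+ \<omega>. indicator (alive k) \<omega> * ennreal (combined_sequence S I \<omega> k) \<partial>M) =
      (\<integral>\<^sup>+ \<omega>. indicator (alive k) \<omega> * (\<Sum>l. ennreal (selection (history k \<omega>) l) *
        ennreal (S l (count_list (history k \<omega>) l))) \<partial>M)"
    unfolding combined_sequence_eq
    by (rule nn_integral_alive_select[of k "\<lambda>xs l. ennreal (S l (count_list xs l))"])
  then show ?thesis
    unfolding step_cost_def
    by (simp add: nn_integral_cmult[symmetric] mult.left_commute[of "ennreal _" "indicator _ _"]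
        weight_times_expected_cutoff)
qed

text \<open>Summing the proportionality of costs over all rounds. The factor \<open>r i\<close>
  stays on the left because it may be zero in this locale.\<close>

lemma expected_running_time_le:
  "ennreal (r i) * expected_running_time M (combined_sequence S I) T \<le>
   ennreal (suminf r) * (\<Sum>k. step_cost i k)"
proof -
  have "expected_running_time M (combined_sequence S I) T \<le>
      (\<integral>\<^sup>+ \<omega>. (\<Sum>k. indicator (alive k) \<omega> * ennreal (combined_sequence S I \<omega> k)) \<partial>M)"
    unfolding expected_running_time_def
  proof (intro nn_integral_mono)
    fix \<omega> assume "\<omega> \<in> space M"
    then have "(if \<forall>j<k. ennreal (combined_sequence S I \<omega> j) < T j \<omega>
          then ennreal (combined_sequence S I \<omega> k) else 0) =
        indicator (alive k) \<omega> * ennreal (combined_sequence S I \<omega> k)" for k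
      by (simp add: alive_def indicator_def)
    then show "running_time (combined_sequence S I \<omega>) (\<lambda>k. T k \<omega>) \<le>
        (\<Sum>k. indicator (alive k) \<omega> * ennreal (combined_sequence S I \<omega> k))"
      using running_time_le_suminf[of "combined_sequence S I \<omega>" "\<lambda>k. T k \<omega>"] by simp
  qed
  also have "\<dots> = (\<Sum>k. \<integral>\<^sup>+ \<omega>. indicator (alive k) \<omega> * ennreal (combined_sequence S I \<omega> k) \<partial>M)"
    by (rule nn_integral_suminf) measurable
  finally have "ennreal (r i) * expected_running_time M (combined_sequence S I) T \<le> ennreal (r i) * \<dots>"
    by (rule mult_left_mono) simp
  then show ?thesis
    unfolding ennreal_suminf_cmult[symmetric] weight_times_round_cost .
qed

text \<open>\<open>B n\<close> is a potential: it bounds the cost still to be spent on sequence \<open>i\<close> after \<open>n\<close> unsuccessful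
  rounds of it. Rounds of the other sequences can only end the process.\<close>

lemma suminf_step_cost_le:
  fixes B :: "nat \<Rightarrow> ennreal"
  assumes B: "\<And>n. ennreal (S i n) + ennreal (survival (S i n)) * B (Suc n) \<le> B n"
  shows "(\<Sum>k. step_cost i k) \<le> B 0"
proof -
  \<comment> \<open>The expected potential before round \<open>k\<close>. It drops by at least
    \<open>step_cost i k\<close> in each round, so the costs telescope.\<close>
  define \<Phi> where
    "\<Phi> k = (\<integral>\<^sup>+ \<omega>. indicator (alive k) \<omega> * B (count_list (history k \<omega>) i) \<partial>M)" for k
  have step: "step_cost i k + \<Phi> (Suc k) \<le> \<Phi> k" for k
  proof -
    let ?n = "\<lambda>xs. count_list xs i"
    let ?f = "\<lambda>xs l. ennreal (survival (S l (count_list xs l))) * B (count_list (xs @ [l]) i)"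
    have "\<Phi> (Suc k) = (\<integral>\<^sup>+ \<omega>. indicator (alive k) \<omega> * ?f (history k \<omega>) (I k \<omega>) \<partial>M)"
      unfolding \<Phi>_def history_Suc
      using nn_integral_alive_Suc[of k "\<lambda>xs l. B (count_list (xs @ [l]) i)"]
      by (simp add: combined_sequence_eq)
    also have "\<dots> = (\<integral>\<^sup>+ \<omega>. indicator (alive k) \<omega> *
        (\<Sum>l. ennreal (selection (history k \<omega>) l) * ?f (history k \<omega>) l) \<partial>M)"
      by (rule nn_integral_alive_select)
    finally have "step_cost i k + \<Phi> (Suc k) = (\<integral>\<^sup>+ \<omega>. indicator (alive k) \<omega> *
        (ennreal (selection (history k \<omega>) i) * ennreal (S i (?n (history k \<omega>)))
          + (\<Sum>l. ennreal (selection (history k \<omega>) l) * ?f (history k \<omega>) l)) \<partial>M)"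
      by (simp add: step_cost_def nn_integral_add[symmetric] distrib_left)
    also have "\<dots> \<le> \<Phi> k"
      unfolding \<Phi>_def
    proof (intro nn_integral_mono mult_left_mono)
      fix \<omega>
      define xs where "xs = history k \<omega>"
      \<comment> \<open>The cost of sequence \<open>i\<close> is written as a series with a single
        nonzero term, so that the comparison can be made for each \<open>l\<close>
        separately.\<close>
      let ?c = "\<lambda>l. if l = i then ennreal (selection xs i) * ennreal (S i (?n xs)) else 0"
      have "(\<Sum>l. ?c l) = ennreal (selection xs i) * ennreal (S i (?n xs))"
        using suminf_finite[of "{i}" ?c] by simp
      then have "ennreal (selection xs i) * ennreal (S i (?n xs))
          + (\<Sum>l. ennreal (selection xs l) * ?f xs l) =
          (\<Sum>l. ?c l + ennreal (selection xs l) * ?f xs l)"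
        by (subst suminf_add[symmetric]) auto
      also have "\<dots> \<le> (\<Sum>l. ennreal (selection xs l) * B (?n xs))"
      proof (intro suminf_le)
        fix l
        show "?c l + ennreal (selection xs l) * ?f xs l \<le> ennreal (selection xs l) * B (?n xs)"
        proof (cases "l = i")
          case True
          then show ?thesis
            using mult_left_mono[OF B[of "?n xs"], of "ennreal (selection xs i)"]
            by (simp add: distrib_left)
        next
          case False
          \<comment> \<open>Selecting another sequence leaves the count of \<open>i\<close>, and
            hence the potential, unchanged.\<close>
          have "?f xs l \<le> 1 * B (?n xs)"
            using False survival_le_1 by (intro mult_mono) auto
          then show ?thesis
            using False by (auto intro: mult_left_mono)
        qed
      qed auto
      also have "\<dots> = B (?n xs)"
        by (simp add: ennreal_suminf_multc suminf_selection)
      finally show "ennreal (selection (history k \<omega>) i) * ennreal (S i (?n (history k \<omega>)))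
          + (\<Sum>l. ennreal (selection (history k \<omega>) l) * ?f (history k \<omega>) l) \<le> B (?n (history k \<omega>))"
        by (simp add: xs_def)
    qed simp
    finally show ?thesis .
  qed
  have "(\<Sum>k<n. step_cost i k) + \<Phi> n \<le> \<Phi> 0" for n
  proof (induction n)
    case (Suc n)
    have "(\<Sum>k<Suc n. step_cost i k) + \<Phi> (Suc n) = (\<Sum>k<n. step_cost i k) + (step_cost i n + \<Phi> (Suc n))"
      by (simp add: add.assoc)
    also have "\<dots> \<le> (\<Sum>k<n. step_cost i k) + \<Phi> n"
      by (intro add_left_mono step)
    finally show ?case
      using Suc by (rule order_trans)
  qed simp
  then have "(\<Sum>k<n. step_cost i k) \<le> \<Phi> 0" for n
    using add_increasing2[of "\<Phi> n" "\<Sum>k<n. step_cost i k"] by (meson order_refl order_trans zero_le)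
  moreover have "\<Phi> 0 = B 0"
  proof -
    have "\<Phi> 0 = (\<integral>\<^sup>+ \<omega>. B 0 \<partial>M)"
      unfolding \<Phi>_def by (intro nn_integral_cong) (simp add: history_def alive_def)
    then show ?thesis
      by (simp add: emeasure_space_1)
  qed
  ultimately show ?thesis
    by (intro suminf_le_const) auto
qed

end

section \<open>Geometric cutoffs and their potential\<close>

lemma geometric_cutoffs_eq: "geometric_cutoffs i k = (1 / (1 - 1 / (4 * 2 ^ i))) ^ k"
proof -
  have "(2::real) powi (- int i - 2) = 1 / (4 * 2 ^ i)"
    by (simp add: power_int_diff power_int_minus field_simps)
  then show ?thesis
    by (simp add: geometric_cutoffs_def power_int_minus power_one_over inverse_eq_divide)
qed

text \<open>The potential solves the recursion with equality on either side of the level \<open>a\<close> (for the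
  extreme values \<open>1\<close> and \<open>1 - 2 * e\<close> of \<open>d\<close>); the constant
  \<open>2 * a / e\<close> is the smallest one that works for every possible crossing of the level.\<close>

lemma geometric_potential:
  fixes a e :: real and d :: "nat \<Rightarrow> real"
  defines "b \<equiv> \<lambda>n. (1 / (1 - e)) ^ n"
  defines "B \<equiv> \<lambda>n. if b n < a then 2 * a / e - b n * (1 - e) / e else b n * (1 - e) / e"
  assumes e: "0 < e" "e \<le> 1 / 4"
    and d: "\<And>n. 0 \<le> d n" "\<And>n. d n \<le> 1" "\<And>n. a \<le> b n \<Longrightarrow> d n \<le> 1 - 2 * e"
  shows "0 \<le> B n" "b n + d n * B (Suc n) \<le> B n"
proof -
  have b_pos: "0 < b m" for m
    using e by (simp add: b_def)
  have b_Suc: "b (Suc m) = b m / (1 - e)" for m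
    by (simp add: b_def)
  have b_inc: "b m \<le> b (Suc m)" for m
    using b_pos[of m] e by (simp add: b_Suc field_simps)
  show nonneg: "0 \<le> B n" for n
  proof (cases "b n < a")
    case True
    have "b n * (1 - e) \<le> b n * 1"
      using b_pos[of n] e by (intro mult_left_mono) auto
    then have "b n * (1 - e) \<le> 2 * a"
      using True b_pos[of n] by linarith
    then show ?thesis
      using True e by (simp add: B_def divide_right_mono)
  next
    case False
    then show ?thesis
      using b_pos[of n] e by (simp add: B_def)
  qed
  have up: "b (Suc n) * (1 - e) / e = b n / e"
    using e by (simp add: b_Suc)
  show "b n + d n * B (Suc n) \<le> B n"
  proof (cases "b n < a")
    case True
    have "d n * B (Suc n) \<le> B (Suc n)"
      using mult_right_mono[OF d(2) nonneg] by simp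
    \<comment> \<open>If \<open>b (Suc n)\<close> is still below \<open>a\<close>, this is an
      equality; at a crossing it reduces to \<open>2 * b n / e \<le> 2 * a / e\<close>.\<close>
    moreover have "b n + B (Suc n) \<le> B n"
      using True e by (simp add: B_def up) (simp add: field_simps)
    ultimately show ?thesis by linarith
  next
    case False
    then have "\<not> b (Suc n) < a"
      using b_inc[of n] by linarith
    then have "B (Suc n) = b n / e" "B n = b n * (1 - e) / e"
      using False by (simp_all add: B_def up)
    moreover have "d n * (b n / e) \<le> (1 - 2 * e) * (b n / e)"
      using False d(3) b_pos[of n] e by (intro mult_right_mono) auto
    \<comment> \<open>Up to the factor \<open>b n / e\<close> this is
      \<open>e + (1 - 2 * e) = 1 - e\<close>.\<close>
    moreover have "b n + (1 - 2 * e) * (b n / e) = b n * (1 - e) / e"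
      using e by (simp add: field_simps)
    ultimately show ?thesis by simp
  qed
qed

section \<open>The bound for each \<open>q\<close> and the infimum\<close>

theorem theorem3:
  fixes C :: real and \<phi> :: "nat \<Rightarrow> real"
    and p :: "ennreal measure" and M :: "'a measure"
    and I :: "nat \<Rightarrow> 'a \<Rightarrow> nat" and T :: "nat \<Rightarrow> 'a \<Rightarrow> ennreal"
  assumes "C > 0"
    and "\<And>i. \<phi> i > 0"
    and "summable (\<lambda>i. 1 / \<phi> i)"
    and "(\<Sum>i. 1 / \<phi> i) \<le> C"
    and "index_selection M (\<lambda>i. 1 / (C * \<phi> i)) geometric_cutoffs I"
    and "running_time_distribution p"
    and "fresh_runs M p I T"
  shows "expected_running_time M (combined_sequence geometric_cutoffs I) T \<le>
    ennreal (8 * C) *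
      (INF q\<in>{0<..1::real}. quantile p q / ennreal q * ennreal (\<phi> (nat \<lfloor>log 2 (1 / q)\<rfloor>)))"
proof -
  let ?r = "\<lambda>i. 1 / (C * \<phi> i)"
  let ?E = "expected_running_time M (combined_sequence geometric_cutoffs I) T"
  interpret index_selection M ?r geometric_cutoffs I by fact
  interpret fresh_runs M p I T by fact
  have r_sums: "?r sums ((\<Sum>i. 1 / \<phi> i) / C)"
    using sums_divide[OF summable_sums[OF assms(3)], of C] by (simp add: mult.commute)
  have r_le_1: "suminf ?r \<le> 1"
    using sums_unique[OF r_sums] assms(1,4) by (simp add: field_simps)
  interpret restarted_selection M ?r geometric_cutoffs I p T
  proof
    show "0 \<le> ?r i" for i
      using assms(1) assms(2)[of i] by simp
    show "summable ?r"
      using r_sums by (rule sums_summable)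
    show "\<exists>i. 0 < ?r i"
      using assms(1,2) by (intro exI[of _ 0]) simp
    show "1 \<le> geometric_cutoffs i k" for i k
    proof -
      have "(1::real) < 4 * 2 ^ i"
        using one_le_power[of "2::real" i] by linarith
      then show ?thesis
        unfolding geometric_cutoffs_eq by (intro one_le_power) (simp add: field_simps)
    qed
  qed
  interpret p: prob_space p
    using assms(6) by (simp add: running_time_distribution_def)
  have sets_p: "sets p = sets borel"
    using assms(6) by (simp add: running_time_distribution_def)
  have bound: "?E \<le> ennreal (8 * C) * (quantile p q / ennreal q * ennreal (\<phi> (nat \<lfloor>log 2 (1 / q)\<rfloor>)))"
    if q: "q \<in> {0<..1}" for q
  proof -
    define i where "i = nat \<lfloor>log 2 (1 / q)\<rfloor>"
    have q01: "0 < q" "q \<le> 1"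
      using q by auto
    have "0 \<le> log 2 (1 / q)"
      using q01 by (simp add: log_divide)
    then have "real i \<le> log 2 (1 / q)" "log 2 (1 / q) < real i + 1"
      unfolding i_def by linarith+
    then have "2 powr real i \<le> 1 / q" "1 / q < 2 powr (real i + 1)"
      using q01 by (simp_all add: le_log_iff log_less_iff)
    then have i: "2 ^ i * q \<le> 1" "1 < 2 * 2 ^ i * q"
      using q01 by (simp_all add: powr_realpow powr_add field_simps)
    define e :: real where "e = 1 / (4 * 2 ^ i)"
    \<comment> \<open>The two sides of \<open>2 ^ i \<le> 1 / q < 2 * 2 ^ i\<close> give
      \<open>1 / e \<le> 4 / q\<close> and \<open>2 * e \<le> q\<close> respectively.\<close>
    have e: "0 < e" "e \<le> 1 / 4" "2 * e \<le> q" "1 / e \<le> 4 / q"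
      using i q01 by (simp_all add: e_def field_simps)
    show ?thesis
    proof (cases "quantile p q = top")
      case True
      then have "ennreal (8 * C) * (quantile p q / ennreal q * ennreal (\<phi> i)) = top"
        using assms(1) assms(2)[of i] q01 by (simp add: ennreal_top_divide ennreal_top_mult ennreal_mult_top)
      then show ?thesis by (simp add: i_def)
    next
      case False
      then obtain a where a: "quantile p q = ennreal a" "0 \<le> a"
        by (cases "quantile p q") auto
      have "1 \<le> a"
        using quantile_attained(1)[OF assms(6) q01(2)] a by simp
      define b where "b n = (1 / (1 - e)) ^ n" for n
      define B where
        "B n = (if b n < a then 2 * a / e - b n * (1 - e) / e else b n * (1 - e) / e)" for n
      have cutoffs: "geometric_cutoffs i n = b n" for n
        by (simp add: geometric_cutoffs_eq b_def e_def)
      \<comment> \<open>From the quantile on, a run fails with probability at most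
        \<open>1 - q\<close>.\<close>
      have survival: "survival (b n) \<le> 1 - 2 * e" if "a \<le> b n" for n
      proof -
        have "q \<le> measure p {..ennreal a}"
          using quantile_attained(2)[OF assms(6) q01(2)] a by simp
        also have "\<dots> \<le> measure p {..ennreal (b n)}"
          using that by (intro p.finite_measure_mono) (auto simp: sets_p intro: order_trans ennreal_leI)
        also have "\<dots> = 1 - survival (b n)"
        proof -
          have "{ennreal (b n)<..} = space p - {..ennreal (b n)}"
            using sets_eq_imp_space_eq[OF sets_p] by auto
          then show ?thesis
            by (simp add: survival_def p.prob_compl sets_p)
        qed
        finally show ?thesis
          using e by linarith
      qed
      have potential: "0 \<le> B n" "b n + survival (b n) * B (Suc n) \<le> B n" for n
        using geometric_potential[of e "\<lambda>n. survival (b n)" a n] e survival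
          survival_nonneg survival_le_1
        unfolding b_def[symmetric] B_def[symmetric] by auto
      have "ennreal (?r i) * ?E \<le> ennreal (suminf ?r) * (\<Sum>k. step_cost i k)"
        by (rule expected_running_time_le)
      also have "(\<Sum>k. step_cost i k) \<le> ennreal (B 0)"
      proof (rule suminf_step_cost_le[of i "\<lambda>n. ennreal (B n)"])
        fix n
        have "0 \<le> b n"
          using e by (simp add: b_def)
        then show "ennreal (geometric_cutoffs i n) +
            ennreal (survival (geometric_cutoffs i n)) * ennreal (B (Suc n)) \<le> ennreal (B n)"
          using potential(1)[of "Suc n"] potential(2)[of n] survival_nonneg
          by (simp add: cutoffs ennreal_mult[symmetric] ennreal_plus[symmetric] ennreal_leI
              del: ennreal_plus)
      qed
      also have "ennreal (suminf ?r) * ennreal (B 0) \<le> 1 * ennreal (B 0)"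
        using r_le_1 by (intro mult_right_mono) auto
      finally have "ennreal (?r i) * ?E \<le> ennreal (B 0)"
        by (simp add: mult_left_mono)
      \<comment> \<open>The weight \<open>1 / (C * \<phi> i)\<close> is cancelled by its inverse,
        which brings \<open>C * \<phi> i\<close> into the bound.\<close>
      then have "ennreal (C * \<phi> i) * (ennreal (?r i) * ?E) \<le> ennreal (C * \<phi> i) * ennreal (B 0)"
        by (rule mult_left_mono) simp
      moreover have "ennreal (C * \<phi> i) * ennreal (?r i) = 1"
        using assms(1) assms(2)[of i] by (simp add: ennreal_mult'[symmetric])
      ultimately have "?E \<le> ennreal (C * \<phi> i) * ennreal (B 0)"
        by (simp add: mult.assoc[symmetric])
      also have "\<dots> \<le> ennreal (C * \<phi> i) * ennreal (8 * a / q)"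
      proof (intro mult_left_mono ennreal_leI)
        \<comment> \<open>As \<open>b 0 = 1 \<le> a\<close>, this covers the case
          \<open>a = 1\<close>; for \<open>1 < a\<close> a nonnegative term is dropped. The constant
          8 is the 2 here times the 4 in \<open>1 / e \<le> 4 / q\<close>.\<close>
        have "(1 - e) / e \<le> 2 * a / e"
          using \<open>1 \<le> a\<close> e by (intro divide_right_mono) auto
        then have "B 0 \<le> 2 * a * (1 / e)"
          using e by (simp add: B_def b_def)
        also have "\<dots> \<le> 2 * a * (4 / q)"
          using e a by (intro mult_left_mono) auto
        finally show "B 0 \<le> 8 * a / q" by simp
      qed simp
      also have "\<dots> = ennreal (8 * C) * (ennreal a / ennreal q * ennreal (\<phi> i))"
        using assms(1) assms(2)[of i] a q01
        by (simp add: divide_ennreal ennreal_mult[symmetric] mult_ac)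
      finally show ?thesis
        by (simp add: a i_def)
    qed
  qed
  let ?c = "ennreal (8 * C)"
  \<comment> \<open>Dividing by the positive finite constant leaves a bare infimum on the right, so
    the bounds for single \<open>q\<close> apply.\<close>
  have "?E / ?c \<le> (INF q\<in>{0<..1::real}. quantile p q / ennreal q * ennreal (\<phi> (nat \<lfloor>log 2 (1 / q)\<rfloor>)))"
    using bound assms(1) by (intro INF_greatest divide_le_posI_ennreal) auto
  then have "?c * (?E / ?c) \<le> ?c * (INF q\<in>{0<..1::real}. quantile p q / ennreal q * ennreal (\<phi> (nat \<lfloor>log 2 (1 / q)\<rfloor>)))"
    by (rule mult_left_mono) simp
  moreover have "?c * (?E / ?c) = ?E"
    using assms(1) by (simp add: ennreal_times_divide ennreal_mult_divide_eq mult.commute)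
  ultimately show ?thesis by simp
qed

end
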